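(* Consider a continuous-price one-side limit order book with homogeneous Poisson arrival of (unit-size) market orders with intensity $\mu$, spatial Poisson arrival of (unit-size) limit orders with intensity $\lambda(p,t)=\alpha h_\lambda(p)$ (price $p\ge 0$, time $t\ge 0$), and exponentially distributed lifetimes of non-executed limit orders with parameter $\theta>0$. Put $\delta=\mu/\theta$, $h(p)=\alpha h_\lambda(p)/\theta$, $H(p)=\int_0^p h(u)\,du$, and $$g_\delta(y)=\frac{e^{-y}y^{\delta}}{\delta\,\Gamma_y(\delta)},\qquad \Gamma_y(x)=\int_0^y t^{x-1}e^{-t}\,dt .$$ Let $B(p)=\mathbf E[L([0,p])]$ be the average cumulative shape of the order book up to price $p$ and $b(p)=\frac{dB(p)}{dp}$ the average shape of the order book. Then for all $p\in[0,\infty)$, $$b(p)=h(p)\left[1-\delta\, g_\delta(H(p))\left[1-\frac{\delta}{H(p)}\bigl[1-g_\delta(H(p))\bigr]\right]\right].$$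
   Context: One-side order book model: all limit orders are sell (ask) orders, all market orders are buy orders, and every order has unit size. Prices are non-negative reals. The function $h_\lambda:\mathbb R_+\to\mathbb R_+$ is the spatial intensity function of limit orders and $\alpha$ is a constant. Limit orders are the points of a Poisson process on (price, time) space $\mathbb R_+^2$ with intensity $\alpha h_\lambda(p)$; thus limit orders with price in $[p_1,p_2]$ arrive according to a homogeneous Poisson process of rate $\alpha\int_{p_1}^{p_2}h_\lambda(u)\,du$, and these processes are independent for disjoint price intervals. Market orders arrive according to an independent Poisson process of rate $\mu$; each market order executes (removes) the standing limit order with the lowest price, if any. Each standing limit order that has not been executed is cancelled after an exponential time of parameter $\theta$ from its submission; these times are mutually independent and independent of the arrivals. $L([0,p])$ denotes the number of limit orders with price in $[0,p]$ standing in the book. As a process in time it is a birth-and-death process on $\{0,1,2,\dots\}$ with birth rate $\alpha\int_0^p h_\lambda(u)\,du$ in every state and death rate $\mu+n\theta$ in state $n\ge1$ (the size of an $M/M/1+M$ queue with arrival rate $\alpha\int_0^p h_\lambda(u)\,du$, service rate $\mu$ and reneging rate $\theta$); $\mathbf E[L([0,p])]$ is its mean under its stationary distribution.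
   Formalization: h_λ is assumed locally integrable and continuous at the price p considered (changing h_λ at one point falsifies the formula); where H(p)=0, in particular at p=0, the undefined bracket is replaced by its limit as H→0+, and the derivative at p=0 is right-sided. *)

theory Defs
  imports "HOL-Probability.Probability"
begin

text \<open>
  Time-homogeneous continuous-time Markov chains on a countable state space. The transition
  probabilities form a semigroup of probability mass functions, so every transition function is
  honest (its rows sum to one), and \<open>P t i\<close> is the law at time \<open>t\<close> of the chain started in \<open>i\<close>.
\<close>

definition markov_semigroup :: "(real \<Rightarrow> 'a \<Rightarrow> 'a pmf) \<Rightarrow> bool" where
  "markov_semigroup P \<longleftrightarrow>
     (\<forall>i. P 0 i = return_pmf i) \<and>
     (\<forall>s\<ge>0. \<forall>t\<ge>0. \<forall>i. P (s + t) i = bind_pmf (P s i) (P t))"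

definition has_generator :: "(real \<Rightarrow> 'a \<Rightarrow> 'a pmf) \<Rightarrow> ('a \<Rightarrow> 'a \<Rightarrow> real) \<Rightarrow> bool" where
  "has_generator P Q \<longleftrightarrow>
     (\<forall>i j. ((\<lambda>t. pmf (P t i) j) has_real_derivative Q i j) (at 0 within {0..}))"

text \<open>
  The Markov property is the usual product rule for finite-dimensional distributions, in a form that
  does not divide by the probability of the conditioning event.
\<close>

definition markov_process_with ::
    "'w measure \<Rightarrow> (real \<Rightarrow> 'w \<Rightarrow> 'a) \<Rightarrow> (real \<Rightarrow> 'a \<Rightarrow> 'a pmf) \<Rightarrow> bool" where
  "markov_process_with M X P \<longleftrightarrow>
     prob_space M \<and>
     (\<forall>t\<ge>0. X t \<in> measurable M (count_space UNIV)) \<and>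
     (\<forall>(ts :: nat \<Rightarrow> real) (xs :: nat \<Rightarrow> 'a) n. 0 \<le> ts 0 \<and> mono ts \<longrightarrow>
        measure M {w \<in> space M. \<forall>k\<le>Suc n. X (ts k) w = xs k} =
        measure M {w \<in> space M. \<forall>k\<le>n. X (ts k) w = xs k} *
        pmf (P (ts (Suc n) - ts n) (xs n)) (xs (Suc n)))"

definition ctmc :: "'w measure \<Rightarrow> (real \<Rightarrow> 'w \<Rightarrow> 'a) \<Rightarrow> ('a \<Rightarrow> 'a \<Rightarrow> real) \<Rightarrow> bool" where
  "ctmc M X Q \<longleftrightarrow>
     (\<exists>P. markov_semigroup P \<and> has_generator P Q \<and> markov_process_with M X P)"

text \<open>
  For a time-homogeneous Markov process, constancy in time of the one-dimensional marginals says
  that the process is started in (and hence stays in) a stationary distribution.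
\<close>

definition stationary_ctmc ::
    "'w measure \<Rightarrow> (real \<Rightarrow> 'w \<Rightarrow> 'a) \<Rightarrow> ('a \<Rightarrow> 'a \<Rightarrow> real) \<Rightarrow> bool" where
  "stationary_ctmc M X Q \<longleftrightarrow>
     ctmc M X Q \<and>
     (\<forall>t\<ge>0. distr M (count_space UNIV) (X t) = distr M (count_space UNIV) (X 0))"

definition birth_death_generator ::
    "(nat \<Rightarrow> real) \<Rightarrow> (nat \<Rightarrow> real) \<Rightarrow> nat \<Rightarrow> nat \<Rightarrow> real" where
  "birth_death_generator birth death i j =
     (if j = Suc i then birth i
      else if i = Suc j then death i
      else if i = j then - (birth i + (if i = 0 then 0 else death i))
      else 0)"

text \<open>
  Generator of the number of standing limit orders in a price range: limit orders with a price in
  the range are submitted at rate \<open>lam\<close>; when \<open>n \<ge> 1\<close> orders stand, one of them is executed by a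
  market order at rate \<open>\<mu>\<close> and each of them is cancelled at rate \<open>\<theta>\<close> (queue M/M/1+M). The value of
  the death rate at \<open>0\<close> is never used.
\<close>

definition order_queue_generator :: "real \<Rightarrow> real \<Rightarrow> real \<Rightarrow> nat \<Rightarrow> nat \<Rightarrow> real" where
  "order_queue_generator lam \<mu> \<theta> =
     birth_death_generator (\<lambda>n. lam) (\<lambda>n. \<mu> + real n * \<theta>)"

text \<open>\<open>lower_Gamma y x\<close> is the lower incomplete gamma function \<open>\<Gamma>\<^sub>y(x)\<close>.\<close>

definition lower_Gamma :: "real \<Rightarrow> real \<Rightarrow> real" where
  "lower_Gamma y x = integral {0..y} (\<lambda>t. t powr (x - 1) * exp (- t))"

text \<open>Meaningful for \<open>\<delta> > 0\<close> and \<open>y > 0\<close>; at \<open>y = 0\<close> the quotient is \<open>0 / 0\<close>.\<close>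

definition g_fun :: "real \<Rightarrow> real \<Rightarrow> real" where
  "g_fun \<delta> y = exp (- y) * y powr \<delta> / (\<delta> * lower_Gamma y \<delta>)"

end

(* The flux of a stationary law across the edge between n and n + 1 is nondecreasing in n (this uses
   only finite partial sums of pi = pi P_t, so no forward equation is needed); it is nonnegative at 0
   and tends to 0, hence it vanishes. Detailed balance gives pi_n = y^n / ((delta + 1)_n Z(y)) with
   y = H(p) and Z(y) = sum_n y^n / (delta + 1)_n, and summing it over n gives
   E L = y - delta + delta / Z(y). The power series Z satisfies y Z' + delta Z = delta + y Z; this
   yields both g_delta = 1 / Z and the derivative of the mean. *)
theory Submission
  imports Defs
begin

section \<open>Stationary laws and the generator\<close>

text \<open>Splitting \<open>X t = j\<close> according to a start in the finite set \<open>A\<close>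
  gives disjoint subevents. With finitely many terms, the left side can later be differentiated in
  \<open>t\<close> without exchanging limits.\<close>

lemma finite_sum_transition_le:
  assumes mp: "markov_process_with M X P" and "0 \<le> t" "finite A"
  shows "(\<Sum>i\<in>A. measure M {w \<in> space M. X 0 w = i} * pmf (P t i) j)
           \<le> measure M {w \<in> space M. X t w = j}"
proof -
  interpret prob_space M
    using mp by (simp add: markov_process_with_def)
  have [measurable]: "X 0 \<in> measurable M (count_space UNIV)" "X t \<in> measurable M (count_space UNIV)"
    using mp \<open>0 \<le> t\<close> by (auto simp: markov_process_with_def)
  have joint: "measure M {w \<in> space M. X 0 w = i} * pmf (P t i) j =
      measure M {w \<in> space M. X 0 w = i \<and> X t w = j}" for i
  proof -
    \<comment> \<open>The product rule is used at the two times 0 and \<open>t\<close>. Staying at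
      \<open>t\<close> afterwards makes \<open>ts\<close> monotone on all of the naturals.\<close>
    define ts where "ts k = (if k = 0 then 0 else t)" for k :: nat
    define xs where "xs k = (if k = 0 then i else j)" for k :: nat
    have "mono ts"
      using \<open>0 \<le> t\<close> by (auto simp: ts_def mono_def)
    moreover have "0 \<le> ts 0"
      by (simp add: ts_def)
    ultimately have "measure M {w \<in> space M. \<forall>k\<le>Suc 0. X (ts k) w = xs k} =
        measure M {w \<in> space M. \<forall>k\<le>0. X (ts k) w = xs k} *
        pmf (P (ts (Suc 0) - ts 0) (xs 0)) (xs (Suc 0))"
      using mp[unfolded markov_process_with_def, THEN conjunct2, THEN conjunct2, rule_format, of ts]
      by blast
    moreover have "(\<forall>k\<le>Suc 0. X (ts k) w = xs k) \<longleftrightarrow> X 0 w = i \<and> X t w = j" for w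
      by (auto simp: ts_def xs_def le_Suc_eq)
    ultimately show ?thesis
      by (simp add: ts_def xs_def)
  qed
  have "(\<Sum>i\<in>A. measure M {w \<in> space M. X 0 w = i} * pmf (P t i) j) =
      measure M (\<Union>i\<in>A. {w \<in> space M. X 0 w = i \<and> X t w = j})"
    unfolding joint
    by (rule finite_measure_finite_Union[symmetric])
       (use \<open>finite A\<close> in \<open>auto simp: disjoint_family_on_def\<close>)
  also have "\<dots> \<le> measure M {w \<in> space M. X t w = j}"
    by (rule finite_measure_mono) auto
  finally show ?thesis .
qed

lemma stationary_marginal:
  assumes "stationary_ctmc M X Q" "0 \<le> t"
  shows "measure M {w \<in> space M. X t w = j} = measure M {w \<in> space M. X 0 w = j}"
proof -
  have m: "X s \<in> measurable M (count_space UNIV)" if "0 \<le> s" for s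
    using assms(1) that by (auto simp: stationary_ctmc_def ctmc_def markov_process_with_def)
  have "measure (distr M (count_space UNIV) (X s)) {j} = measure M {w \<in> space M. X s w = j}"
    if "0 \<le> s" for s
    using m[OF that] by (subst measure_distr) (auto intro!: arg_cong[where f = "measure M"])
  then show ?thesis
    using assms by (metis order_refl stationary_ctmc_def)
qed

text \<open>One-sided substitute for global balance. The finite sum \<open>f t\<close> equals
  \<open>m j\<close> at time 0, because \<open>j \<in> A\<close>, and by stationarity never exceeds
  \<open>m j\<close> later, so its right derivative at 0 cannot be positive.\<close>

lemma stationary_finite_generator_sum_nonpos:
  assumes st: "stationary_ctmc M X Q" and A: "finite A" "j \<in> A"
  shows "(\<Sum>i\<in>A. measure M {w \<in> space M. X 0 w = i} * Q i j) \<le> 0"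
proof (rule ccontr)
  obtain P where P: "markov_semigroup P" "has_generator P Q" "markov_process_with M X P"
    using st by (auto simp: stationary_ctmc_def ctmc_def)
  define m where "m i = measure M {w \<in> space M. X 0 w = i}" for i
  define f where "f t = (\<Sum>i\<in>A. m i * pmf (P t i) j)" for t
  assume "\<not> ?thesis"
  then have pos: "0 < (\<Sum>i\<in>A. m i * Q i j)"
    by (simp add: m_def)
  have "(f has_real_derivative (\<Sum>i\<in>A. m i * Q i j)) (at 0 within {0..})"
    unfolding f_def using P(2)
    by (auto simp: has_generator_def intro!: DERIV_sum DERIV_cmult)
  from has_real_derivative_pos_inc_right[OF this pos]
  obtain d where d: "d > 0" "\<And>h. 0 < h \<Longrightarrow> h < d \<Longrightarrow> f 0 < f h"
    by auto
  have "f 0 = (\<Sum>i\<in>A. if i = j then m i else 0)"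
    unfolding f_def using P(1)
    by (intro sum.cong) (auto simp: markov_semigroup_def)
  then have "f 0 = m j"
    using A by simp
  moreover have "f (d / 2) \<le> m j"
    using finite_sum_transition_le[OF P(3) _ A(1), of "d / 2" j] stationary_marginal[OF st, of "d / 2" j]
      \<open>d > 0\<close>
    by (simp add: f_def m_def)
  ultimately show False
    using d(2)[of "d / 2"] \<open>d > 0\<close> by simp
qed

section \<open>Random variables with values in the naturals\<close>

lemma sums_measure_nat_valued:
  fixes X :: "'w \<Rightarrow> nat"
  assumes "prob_space M" "X \<in> measurable M (count_space UNIV)"
  shows "(\<lambda>n. measure M {w \<in> space M. X w = n}) sums 1"
proof -
  interpret prob_space M by fact
  note [measurable] = assms(2)
  have "(\<lambda>n. measure M {w \<in> space M. X w = n}) sums measure M (\<Union>n. {w \<in> space M. X w = n})"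
    by (rule finite_measure_UNION) (auto simp: disjoint_family_on_def)
  also have "(\<Union>n. {w \<in> space M. X w = n}) = space M"
    by auto
  finally show ?thesis
    by (simp add: prob_space)
qed

lemma integral_nat_valued:
  fixes X :: "'w \<Rightarrow> nat" and f :: "nat \<Rightarrow> real"
  assumes "finite_measure M" and X: "X \<in> measurable M (count_space UNIV)"
    and nonneg: "\<And>n. 0 \<le> f n"
    and s: "(\<lambda>n. measure M {w \<in> space M. X w = n} * f n) sums s"
  shows "(LINT w|M. f (X w)) = s"
proof -
  interpret finite_measure M by fact
  define m where "m n = measure M {w \<in> space M. X w = n}" for n
  have dens: "distr M (count_space UNIV) X = density (count_space UNIV) (\<lambda>n. ennreal (m n))"
  proof (rule measure_eqI_countable)
    fix n :: nat
    show "emeasure (distr M (count_space UNIV) X) {n} =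
        emeasure (density (count_space UNIV) (\<lambda>n. ennreal (m n))) {n}"
      using X by (subst emeasure_distr)
        (auto simp: emeasure_density m_def emeasure_eq_measure nn_integral_count_space_indicator[symmetric]
          nn_integral_count_space_finite intro!: arg_cong[where f = "measure M"])
  qed auto
  have "(LINT w|M. f (X w)) = (LINT n|distr M (count_space UNIV) X. f n)"
    using X by (subst integral_distr) auto
  also have "\<dots> = (LINT n|count_space UNIV. m n * f n)"
    unfolding dens by (subst integral_density) (auto simp: m_def)
  also have "\<dots> = s"
  proof -
    \<comment> \<open>Nonnegativity makes the convergent series absolutely convergent. Without
      integrability the Lebesgue integral would take its default value 0.\<close>
    have "integrable (count_space UNIV) (\<lambda>n. m n * f n)"
      using s nonneg by (auto simp: integrable_count_space_nat_iff m_def sums_iff abs_mult)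
    from sums_integral_count_space_nat[OF this] s show ?thesis
      by (simp add: m_def sums_unique2)
  qed
  finally show ?thesis .
qed

section \<open>Detailed balance for the order queue\<close>

lemma order_queue_detailed_balance:
  fixes X :: "real \<Rightarrow> 'w \<Rightarrow> nat"
  assumes st: "stationary_ctmc M X (order_queue_generator lam \<mu> \<theta>)"
    and nonneg: "0 \<le> \<mu>" "0 \<le> \<theta>"
  defines "m \<equiv> \<lambda>n. measure M {w \<in> space M. X 0 w = n}"
  shows "lam * m n = (\<mu> + real (Suc n) * \<theta>) * m (Suc n)"
proof -
  \<comment> \<open>Net upward flux across the edge between \<open>n\<close> and
    \<open>Suc n\<close>.\<close>
  define f where "f n = lam * m n - (\<mu> + real (Suc n) * \<theta>) * m (Suc n)" for n
  have X: "prob_space M" "X 0 \<in> measurable M (count_space UNIV)"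
    using st by (auto simp: stationary_ctmc_def ctmc_def markov_process_with_def)
  \<comment> \<open>The chosen states are those with a possibly nonzero entry in column 0 of the
    generator; the diagonal entry there is \<open>- lam\<close>, since no death occurs at 0.\<close>
  have "m 0 * - lam + m (Suc 0) * (\<mu> + \<theta>) \<le> 0"
    using stationary_finite_generator_sum_nonpos[OF st, of "{0, Suc 0}" 0]
    by (simp add: m_def order_queue_generator_def birth_death_generator_def)
  then have f0: "0 \<le> f 0"
    by (simp add: f_def algebra_simps)
  \<comment> \<open>For column \<open>Suc n\<close> the three states again carry all nonzero
    entries, and the generator sum is exactly \<open>f n - f (Suc n)\<close>.\<close>
  have "f n \<le> f (Suc n)" for n
    using stationary_finite_generator_sum_nonpos[OF st, of "{n, Suc n, Suc (Suc n)}" "Suc n"]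
    by (simp add: m_def f_def order_queue_generator_def birth_death_generator_def algebra_simps)
  then have "incseq f"
    by (rule incseq_SucI)
  have "m \<longlonglongrightarrow> 0"
    using sums_measure_nat_valued[OF X] unfolding m_def
    by (intro summable_LIMSEQ_zero) (auto simp: sums_iff)
  then have lim: "(\<lambda>n. lam * m n) \<longlonglongrightarrow> 0"
    by (rule tendsto_mult_right_zero)
  \<comment> \<open>The downward flux has an unbounded rate, so its decay is not clear a priori. It
    is dropped by sign, and only the upward part, which tends to 0, bounds
    \<open>f n\<close>.\<close>
  have "f n \<le> lam * m k" if "n \<le> k" for k
  proof -
    have "f n \<le> f k"
      using \<open>incseq f\<close> that by (rule incseqD)
    also have "\<dots> \<le> lam * m k"
      using nonneg by (simp add: f_def m_def)
    finally show ?thesis .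
  qed
  with lim have "f n \<le> 0"
    by (intro tendsto_lowerbound[OF lim]) (auto simp: eventually_sequentially)
  moreover have "0 \<le> f n"
    using f0 incseqD[OF \<open>incseq f\<close>, of 0 n] by simp
  ultimately show ?thesis
    by (simp add: f_def)
qed

section \<open>The partition function and the incomplete gamma function\<close>

text \<open>Kummer's function 1F1(1; \<delta> + 1; y): the normalising constant of the stationary
  weights when state 0 has weight 1.\<close>

definition queue_partition :: "real \<Rightarrow> real \<Rightarrow> real" where
  "queue_partition \<delta> y = (\<Sum>n. 1 / pochhammer (\<delta> + 1) n * y ^ n)"

text \<open>Naming the termwise derivative as a series of its own gives its continuity at 0, where
  the formula in terms of \<open>g_fun\<close> degenerates.\<close>

definition queue_partition_deriv :: "real \<Rightarrow> real \<Rightarrow> real" where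
  "queue_partition_deriv \<delta> y = (\<Sum>n. diffs (\<lambda>n. 1 / pochhammer (\<delta> + 1) n) n * y ^ n)"

context
  fixes \<delta> :: real
  assumes \<delta>_pos: "0 < \<delta>"
begin

lemma pochhammer_Suc_pos: "0 < pochhammer (\<delta> + 1) n"
  using \<delta>_pos by (intro pochhammer_pos) simp

text \<open>Since \<open>\<delta> > 0\<close>, \<open>pochhammer (\<delta> + 1) n\<close> dominates
  \<open>fact n\<close>, so the exponential series is a majorant at every real
  \<open>y\<close>.\<close>

lemma summable_queue_partition: "summable (\<lambda>n. 1 / pochhammer (\<delta> + 1) n * y ^ n)"
proof (rule summable_comparison_test')
  show "summable (\<lambda>n. inverse (fact n) * \<bar>y\<bar> ^ n)"
    by (rule summable_exp)
  have "fact n \<le> pochhammer (\<delta> + 1) n" for n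
  proof (induction n)
    case (Suc n)
    have "(1 + real n) * fact n \<le> (\<delta> + 1 + real n) * pochhammer (\<delta> + 1) n"
      using Suc \<delta>_pos by (intro mult_mono) auto
    then show ?case
      by (simp add: pochhammer_Suc algebra_simps)
  qed simp
  then have "inverse (pochhammer (\<delta> + 1) n) \<le> inverse (fact n)" for n
    by (intro le_imp_inverse_le) simp_all
  then show "norm (1 / pochhammer (\<delta> + 1) n * y ^ n) \<le> inverse (fact n) * \<bar>y\<bar> ^ n" for n
    using pochhammer_Suc_pos[of n] mult_right_mono[of _ _ "\<bar>y\<bar> ^ n"]
    by (simp add: abs_mult power_abs inverse_eq_divide del: times_divide_eq_left)
qed

lemma queue_partition_has_derivative:
  "(queue_partition \<delta> has_real_derivative queue_partition_deriv \<delta> y) (at y)"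
  unfolding queue_partition_def[abs_def] queue_partition_deriv_def
  by (rule termdiffs_strong_converges_everywhere) (rule summable_queue_partition)

lemma isCont_queue_partition_deriv: "isCont (queue_partition_deriv \<delta>) y"
  unfolding queue_partition_deriv_def[abs_def]
  by (rule isCont_powser_converges_everywhere)
     (rule termdiff_converges_all, rule summable_queue_partition)

lemma queue_partition_0: "queue_partition \<delta> 0 = 1"
  unfolding queue_partition_def by (subst powser_zero) simp

lemma queue_partition_pos: "0 \<le> y \<Longrightarrow> 0 < queue_partition \<delta> y"
  unfolding queue_partition_def using pochhammer_Suc_pos
  by (intro suminf_pos2[where i = 0] summable_queue_partition) (auto simp: less_imp_le)

lemma queue_partition_ode:
  "y * queue_partition_deriv \<delta> y + \<delta> * queue_partition \<delta> y = \<delta> + y * queue_partition \<delta> y"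
proof -
  define c where "c n = 1 / pochhammer (\<delta> + 1) n" for n
  \<comment> \<open>The coefficient form of the differential equation: the left side is the
    coefficient of the derivative series.\<close>
  have rec: "real (Suc n) * c (Suc n) = c n - \<delta> * c (Suc n)" for n
  proof -
    have "(\<delta> + real (Suc n)) * c (Suc n) = c n"
      using \<delta>_pos by (simp add: c_def pochhammer_Suc ac_simps)
    then show ?thesis
      by (simp add: algebra_simps)
  qed
  have Z: "(\<lambda>n. c n * y ^ n) sums queue_partition \<delta> y"
    using summable_queue_partition unfolding queue_partition_def c_def by (rule summable_sums)
  have D: "(\<lambda>n. diffs c n * y ^ n) sums queue_partition_deriv \<delta> y"
    unfolding queue_partition_deriv_def c_def[abs_def]
    by (rule summable_sums, rule termdiff_converges_all, rule summable_queue_partition)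
  \<comment> \<open>The shifted series lacks the constant term \<open>c 0 = 1\<close>; this becomes
    the inhomogeneous term \<open>\<delta>\<close> of the equation.\<close>
  have "(\<lambda>n. c (Suc n) * y ^ Suc n) sums (queue_partition \<delta> y - 1)"
    using Z by (subst sums_Suc_iff) (simp add: c_def)
  from sums_diff[OF sums_mult[OF Z, of y] sums_mult[OF this, of \<delta>]]
  have "(\<lambda>n. y * (diffs c n * y ^ n)) sums
      (y * queue_partition \<delta> y - \<delta> * (queue_partition \<delta> y - 1))"
    by (simp add: diffs_def rec algebra_simps del: of_nat_Suc)
  from sums_unique2[OF sums_mult[OF D] this] show ?thesis
    by (simp add: algebra_simps)
qed

text \<open>The right side vanishes at 0, and by \<open>queue_partition_ode\<close> its derivative
  is the integrand of \<open>lower_Gamma\<close>.\<close>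

lemma lower_Gamma_eq_queue_partition:
  assumes "0 < y"
  shows "lower_Gamma y \<delta> = exp (- y) * y powr \<delta> * queue_partition \<delta> y / \<delta>"
proof -
  define G where "G x = exp (- x) * x powr \<delta> * queue_partition \<delta> x / \<delta>" for x
  have cont: "continuous_on {0..y} G"
    unfolding G_def using \<delta>_pos
    by (intro continuous_intros continuous_on_powr'
          DERIV_continuous_on[OF DERIV_subset[OF queue_partition_has_derivative]]) auto
  have deriv: "(G has_vector_derivative x powr (\<delta> - 1) * exp (- x)) (at x)" if "x \<in> {0<..<y}" for x
  proof -
    have "0 < x"
      using that by simp
    have "(G has_real_derivative
        (- exp (- x) * x powr \<delta> * queue_partition \<delta> x
          + exp (- x) * (\<delta> * x powr (\<delta> - 1)) * queue_partition \<delta> x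
          + exp (- x) * x powr \<delta> * queue_partition_deriv \<delta> x) / \<delta>) (at x)"
      unfolding G_def using \<open>0 < x\<close> \<delta>_pos
      by (auto intro!: derivative_eq_intros queue_partition_has_derivative simp: field_simps)
    also have "x powr \<delta> = x * x powr (\<delta> - 1)"
      using \<open>0 < x\<close> by (simp add: powr_mult_base)
    also have "(- exp (- x) * (x * x powr (\<delta> - 1)) * queue_partition \<delta> x
          + exp (- x) * (\<delta> * x powr (\<delta> - 1)) * queue_partition \<delta> x
          + exp (- x) * (x * x powr (\<delta> - 1)) * queue_partition_deriv \<delta> x) / \<delta>
        = x powr (\<delta> - 1) * exp (- x) *
          ((x * queue_partition_deriv \<delta> x + \<delta> * queue_partition \<delta> x - x * queue_partition \<delta> x) / \<delta>)"
      by (simp add: algebra_simps diff_divide_distrib add_divide_distrib)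
    also have "\<dots> = x powr (\<delta> - 1) * exp (- x)"
      unfolding queue_partition_ode using \<delta>_pos by simp
    finally show ?thesis
      by (simp add: has_real_derivative_iff_has_vector_derivative)
  qed
  \<comment> \<open>For \<open>\<delta> < 1\<close> the integrand is unbounded near 0. The interior
    version of the fundamental theorem asks only for continuity of \<open>G\<close> at the
    endpoints, and \<open>G 0 = 0\<close> because \<open>0 powr \<delta> = 0\<close>.\<close>
  have "((\<lambda>x. x powr (\<delta> - 1) * exp (- x)) has_integral (G y - G 0)) {0..y}"
    using assms cont deriv by (intro fundamental_theorem_of_calculus_interior) auto
  then show ?thesis
    unfolding lower_Gamma_def by (simp add: integral_unique G_def)
qed

lemma g_fun_eq_queue_partition:
  assumes "0 < y"
  shows "g_fun \<delta> y = 1 / queue_partition \<delta> y"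
  using assms \<delta>_pos queue_partition_pos[of y]
  by (simp add: g_fun_def lower_Gamma_eq_queue_partition field_simps)

text \<open>The right side is the derivative of y - \<delta> + \<delta> / Z(y), the mean as a
  function of y. It follows by solving the differential equation for Z', and unlike the left side it
  stays meaningful at y = 0.\<close>

lemma g_fun_expression_eq:
  assumes "0 < y"
  shows "1 - \<delta> * g_fun \<delta> y * (1 - \<delta> / y * (1 - g_fun \<delta> y)) =
    1 - \<delta> * queue_partition_deriv \<delta> y / (queue_partition \<delta> y)\<^sup>2"
proof -
  define Z where "Z = queue_partition \<delta> y"
  have Z: "0 < Z"
    using assms by (simp add: Z_def queue_partition_pos)
  have D: "queue_partition_deriv \<delta> y = (\<delta> + y * Z - \<delta> * Z) / y"
    using queue_partition_ode[of y] assms by (simp add: Z_def field_simps)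
  show ?thesis
    unfolding g_fun_eq_queue_partition[OF assms] D Z_def[symmetric]
    using assms Z by (simp add: field_simps power2_eq_square)
qed

lemma g_fun_expression_tendsto:
  "((\<lambda>y. 1 - \<delta> * g_fun \<delta> y * (1 - \<delta> / y * (1 - g_fun \<delta> y))) \<longlongrightarrow>
     1 - \<delta> * queue_partition_deriv \<delta> 0 / (queue_partition \<delta> 0)\<^sup>2) (at_right 0)"
proof (rule Lim_transform_eventually)
  have "(queue_partition \<delta> \<longlongrightarrow> queue_partition \<delta> 0) (at_right 0)"
    "(queue_partition_deriv \<delta> \<longlongrightarrow> queue_partition_deriv \<delta> 0) (at_right 0)"
    using DERIV_isCont[OF queue_partition_has_derivative[of 0]] isCont_queue_partition_deriv[of 0]
    by (auto simp: isCont_def intro: tendsto_within_subset)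
  then show "((\<lambda>y. 1 - \<delta> * queue_partition_deriv \<delta> y / (queue_partition \<delta> y)\<^sup>2) \<longlongrightarrow>
      1 - \<delta> * queue_partition_deriv \<delta> 0 / (queue_partition \<delta> 0)\<^sup>2) (at_right 0)"
    by (intro tendsto_intros) (auto simp: queue_partition_0)
  show "eventually (\<lambda>y. 1 - \<delta> * queue_partition_deriv \<delta> y / (queue_partition \<delta> y)\<^sup>2 =
      1 - \<delta> * g_fun \<delta> y * (1 - \<delta> / y * (1 - g_fun \<delta> y))) (at_right 0)"
    using g_fun_expression_eq by (auto simp: eventually_at_right_less eventually_at_filter)
qed

end

section \<open>The stationary mean\<close>

lemma order_queue_mean:
  fixes X :: "real \<Rightarrow> 'w \<Rightarrow> nat"
  assumes st: "stationary_ctmc M X (order_queue_generator lam \<mu> \<theta>)"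
    and "0 \<le> lam" "0 < \<mu>" "0 < \<theta>" "0 \<le> t"
  shows "(LINT w|M. real (X t w)) =
    lam / \<theta> - \<mu> / \<theta> + \<mu> / \<theta> / queue_partition (\<mu> / \<theta>) (lam / \<theta>)"
proof -
  define m where "m n = measure M {w \<in> space M. X 0 w = n}" for n
  define \<delta> y where "\<delta> = \<mu> / \<theta>" and "y = lam / \<theta>"
  have "0 < \<delta>" "0 \<le> y"
    using assms by (auto simp: \<delta>_def y_def)
  have X: "prob_space M" "X s \<in> measurable M (count_space UNIV)" if "0 \<le> s" for s
    using st that by (auto simp: stationary_ctmc_def ctmc_def markov_process_with_def)
  interpret prob_space M
    using X by blast
  have m_sums: "m sums 1"
    using sums_measure_nat_valued[OF X, of 0] by (simp add: m_def[abs_def])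
  have bal: "y * m n = (\<delta> + real (Suc n)) * m (Suc n)" for n
    using order_queue_detailed_balance[OF st, of n] \<open>0 < \<mu>\<close> \<open>0 < \<theta>\<close>
    by (simp add: m_def \<delta>_def y_def field_simps)
  \<comment> \<open>Iterating the balance relation fixes the law up to \<open>m 0\<close>; total
    mass 1 then determines \<open>m 0\<close>.\<close>
  have m_eq: "m n = m 0 * (1 / pochhammer (\<delta> + 1) n * y ^ n)" for n
  proof (induction n)
    case (Suc n)
    have "\<delta> + real (Suc n) \<noteq> 0"
      using \<open>0 < \<delta>\<close> by simp
    then have "m (Suc n) = y * m n / (\<delta> + real (Suc n))"
      using bal[of n] by (simp add: field_simps)
    then show ?case
      unfolding Suc by (simp add: pochhammer_Suc algebra_simps)
  qed simp
  have "m sums (m 0 * queue_partition \<delta> y)"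
    unfolding queue_partition_def
    by (subst m_eq[abs_def]) (intro sums_mult summable_sums summable_queue_partition \<open>0 < \<delta>\<close>)
  with m_sums have "m 0 * queue_partition \<delta> y = 1"
    by (simp add: sums_unique2)
  then have m0: "m 0 = 1 / queue_partition \<delta> y"
    using queue_partition_pos[OF \<open>0 < \<delta>\<close> \<open>0 \<le> y\<close>] by (simp add: field_simps)
  have "(\<lambda>n. m (Suc n)) sums (1 - m 0)"
    using m_sums by (subst sums_Suc_iff) simp
  \<comment> \<open>Summing \<open>y * m n - \<delta> * m (Suc n) = real (Suc n) * m (Suc n)\<close>
    over \<open>n\<close> yields the first moment and its convergence at once; the term of index 0
    contributes nothing to it.\<close>
  from sums_diff[OF sums_mult[OF m_sums, of y] sums_mult[OF this, of \<delta>]]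
  have "(\<lambda>n. m (Suc n) * real (Suc n)) sums (y - \<delta> * (1 - m 0))"
    by (simp add: bal algebra_simps)
  then have "(\<lambda>n. m n * real n) sums (y - \<delta> * (1 - m 0))"
    by (subst (asm) sums_Suc_iff) simp
  then have "(LINT w|M. real (X t w)) = y - \<delta> * (1 - m 0)"
    using X \<open>0 \<le> t\<close> stationary_marginal[OF st \<open>0 \<le> t\<close>]
    by (intro integral_nat_valued finite_measure_axioms) (auto simp: m_def)
  then show ?thesis
    by (simp add: m0 \<delta>_def y_def algebra_simps)
qed

section \<open>Differentiation in the price\<close>

lemma integral_has_real_derivative_atLeast:
  fixes f :: "real \<Rightarrow> real"
  assumes "\<And>q. a \<le> q \<Longrightarrow> f integrable_on {a..q}" "a \<le> p" "continuous (at p within {a..}) f"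
  shows "((\<lambda>q. integral {a..q} f) has_real_derivative f p) (at p within {a..})"
proof -
  have "((\<lambda>q. integral {a..q} f) has_vector_derivative f p) (at p within {a..p + 1})"
    using integral_has_vector_derivative_continuous_at[of f a "p + 1" p "{}"] assms(1,2)
      continuous_within_subset[OF assms(3), of "{a..p + 1}"]
    by (simp add: atLeastatMost_subset_iff subset_iff)
  \<comment> \<open>The endpoint \<open>p + 1\<close> lies strictly to the right of
    \<open>p\<close>, so truncating the half-line there does not change the filter; at
    \<open>p = a\<close> the derivative is one-sided.\<close>
  moreover have "at p within {a..p + 1} = at p within {a..}"
    by (rule at_within_nhd[of _ "{..<p + 1}"]) auto
  ultimately show ?thesis
    by (simp add: has_real_derivative_iff_has_vector_derivative)
qed

text \<open>Where \<open>H p = 0\<close>, in particular at \<open>p = 0\<close>, the formula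
  contains quotients 0 / 0 and is read as its limit from the right. Both cases come from one chain
  rule, applied to the mean as a function of \<open>H\<close>.\<close>

theorem proposition1:
  fixes M :: "'w measure"
    and L :: "real \<Rightarrow> real \<Rightarrow> 'w \<Rightarrow> nat"
    and h_lam h H B :: "real \<Rightarrow> real"
    and \<alpha> \<mu> \<theta> \<delta> t p :: real
  assumes "0 \<le> \<alpha>" and "0 < \<mu>" and "0 < \<theta>"
    and "\<And>u. 0 \<le> u \<Longrightarrow> 0 \<le> h_lam u"
    and "\<And>q. 0 \<le> q \<Longrightarrow> h_lam integrable_on {0..q}"
    and "\<And>q. 0 \<le> q \<Longrightarrow>
           stationary_ctmc M (L q) (order_queue_generator (\<alpha> * integral {0..q} h_lam) \<mu> \<theta>)"
    and "\<delta> = \<mu> / \<theta>"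
    and "h = (\<lambda>u. \<alpha> * h_lam u / \<theta>)"
    and "H = (\<lambda>q. integral {0..q} h)"
    and "0 \<le> t"
    and "B = (\<lambda>q. LINT w|M. real (L q t w))"
    and "0 \<le> p"
    and "continuous (at p within {0..}) h_lam"
  shows "(0 < H p \<longrightarrow>
            (B has_real_derivative
               h p * (1 - \<delta> * g_fun \<delta> (H p) * (1 - \<delta> / H p * (1 - g_fun \<delta> (H p)))))
             (at p within {0..})) \<and>
         (H p = 0 \<longrightarrow>
            (\<exists>c. ((\<lambda>y. 1 - \<delta> * g_fun \<delta> y * (1 - \<delta> / y * (1 - g_fun \<delta> y))) \<longlongrightarrow> c) (at_right 0) \<and>
                 (B has_real_derivative h p * c) (at p within {0..})))"
proof -
  \<comment> \<open>Derivative of the mean with respect to \<open>y = H p\<close>, written so that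
    it also covers \<open>y = 0\<close>.\<close>
  define D where "D y = 1 - \<delta> * queue_partition_deriv \<delta> y / (queue_partition \<delta> y)\<^sup>2" for y
  have "0 < \<delta>"
    using assms by simp
  have h_int: "h integrable_on {0..q}" if "0 \<le> q" for q
    using integrable_on_cmult_left[OF assms(5)[OF that], of "\<alpha> / \<theta>"]
    by (simp add: \<open>h = _\<close>)
  have H_eq: "H q = \<alpha> * integral {0..q} h_lam / \<theta>" for q
    using integral_mult_right[of "{0..q}" "\<alpha> / \<theta>" h_lam] by (simp add: \<open>H = _\<close> \<open>h = _\<close>)
  \<comment> \<open>For negative \<open>q\<close> the interval is empty and the integral is
    0.\<close>
  have lam_nonneg: "0 \<le> \<alpha> * integral {0..q} h_lam" for q
  proof (cases "0 \<le> q")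
    case True
    then have "0 \<le> integral {0..q} h_lam"
      using assms(4,5) by (intro integral_nonneg) auto
    then show ?thesis
      using assms(1) by simp
  qed simp
  have H_nonneg: "0 \<le> H q" for q
    using lam_nonneg[of q] \<open>0 < \<theta>\<close> by (simp add: H_eq)
  have B_eq: "B q = H q - \<delta> + \<delta> / queue_partition \<delta> (H q)" if "0 \<le> q" for q
    using order_queue_mean[OF assms(6)[OF that] lam_nonneg assms(2,3,10)]
    by (simp add: \<open>B = _\<close> H_eq \<open>\<delta> = _\<close>)
  have "continuous (at p within {0..}) h"
    unfolding \<open>h = _\<close> using assms(3,13) by (intro continuous_intros) auto
  then have H_deriv: "(H has_real_derivative h p) (at p within {0..})"
    unfolding \<open>H = _\<close> using h_int \<open>0 \<le> p\<close> by (intro integral_has_real_derivative_atLeast)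
  have Z: "queue_partition \<delta> (H p) \<noteq> 0"
    using queue_partition_pos[OF \<open>0 < \<delta>\<close> H_nonneg[of p]] by simp
  have "((\<lambda>y. y - \<delta> + \<delta> / queue_partition \<delta> y) has_real_derivative D (H p)) (at (H p))"
    unfolding D_def
    by (rule derivative_eq_intros queue_partition_has_derivative[OF \<open>0 < \<delta>\<close>] Z refl)+
       (simp add: power2_eq_square)
  from DERIV_chain2[OF this H_deriv]
  have "((\<lambda>q. H q - \<delta> + \<delta> / queue_partition \<delta> (H q)) has_real_derivative h p * D (H p))
      (at p within {0..})"
    by (simp only: mult.commute)
  \<comment> \<open>\<open>B_eq\<close> holds only for \<open>q \<ge> 0\<close>, which is enough for
    a derivative within \<open>{0..}\<close>; the radius 1 is arbitrary.\<close>
  then have B_deriv: "(B has_real_derivative h p * D (H p)) (at p within {0..})"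
    by (rule has_field_derivative_transform_within[OF _ zero_less_one])
       (use \<open>0 \<le> p\<close> B_eq in simp_all)
  show ?thesis
  proof (intro conjI impI exI)
    assume "0 < H p"
    show "(B has_real_derivative
        h p * (1 - \<delta> * g_fun \<delta> (H p) * (1 - \<delta> / H p * (1 - g_fun \<delta> (H p))))) (at p within {0..})"
      unfolding g_fun_expression_eq[OF \<open>0 < \<delta>\<close> \<open>0 < H p\<close>] by (rule B_deriv[unfolded D_def])
  next
    assume "H p = 0"
    \<comment> \<open>The witness for \<open>c\<close> is \<open>D 0\<close>, the continuous
      extension of the formula.\<close>
    show "((\<lambda>y. 1 - \<delta> * g_fun \<delta> y * (1 - \<delta> / y * (1 - g_fun \<delta> y))) \<longlongrightarrow> D 0) (at_right 0)"
      unfolding D_def by (rule g_fun_expression_tendsto[OF \<open>0 < \<delta>\<close>])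
    show "(B has_real_derivative h p * D 0) (at p within {0..})"
      using B_deriv unfolding \<open>H p = 0\<close> .
  qed
qed

end
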